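(* For all integers $n\ge 1$ and $k\ge 1$, $\chi_{la}\big((2k+1)P_2 \vee O_{2n}\big) = 3$.
   Context: For a graph $G$ with $q$ edges, a bijection $f:E(G)\to\{1,2,\dots,q\}$ is a local antimagic labeling if $f^+(u)\neq f^+(v)$ for every edge $uv$, where $f^+(u)$ is the sum of $f(e)$ over all edges $e$ incident to $u$. The local antimagic chromatic number $\chi_{la}(G)$ is the minimum, over all local antimagic labelings $f$ of $G$, of the number of distinct values of $f^+$. $O_m$ denotes the null graph (no edges) on $m$ vertices, $aP_2$ denotes the disjoint union of $a$ copies of the path $P_2$ (a single edge), and $G\vee H$ denotes the join of $G$ and $H$ (disjoint union plus all edges between $V(G)$ and $V(H)$). *)

theory Defs
  imports Main
begin

record 'a graph =
  verts :: "'a set"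
  edges :: "'a set set"

definition simple_graph :: "'a graph \<Rightarrow> bool" where
  "simple_graph G \<longleftrightarrow>
     finite (verts G) \<and> (\<forall>e \<in> edges G. e \<subseteq> verts G \<and> card e = 2)"

definition null_graph :: "nat \<Rightarrow> nat graph" where
  "null_graph m = \<lparr> verts = {..<m}, edges = {} \<rparr>"

definition path_graph :: "nat \<Rightarrow> nat graph" where
  "path_graph n = \<lparr> verts = {..<n}, edges = {{i, Suc i} | i. Suc i < n} \<rparr>"

definition copies :: "nat \<Rightarrow> 'a graph \<Rightarrow> (nat \<times> 'a) graph" where
  "copies a G =
     \<lparr> verts = {..<a} \<times> verts G,
       edges = {Pair i ` e | i e. i < a \<and> e \<in> edges G} \<rparr>"

definition graph_join :: "'a graph \<Rightarrow> 'b graph \<Rightarrow> ('a + 'b) graph" where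
  "graph_join G H =
     \<lparr> verts = verts G <+> verts H,
       edges = image Inl ` edges G \<union> image Inr ` edges H
               \<union> {{Inl u, Inr v} | u v. u \<in> verts G \<and> v \<in> verts H} \<rparr>"

definition vertex_sum :: "'a graph \<Rightarrow> ('a set \<Rightarrow> nat) \<Rightarrow> 'a \<Rightarrow> nat" where
  "vertex_sum G f u = (\<Sum>e \<in> {e \<in> edges G. u \<in> e}. f e)"

definition local_antimagic_labeling :: "'a graph \<Rightarrow> ('a set \<Rightarrow> nat) \<Rightarrow> bool" where
  "local_antimagic_labeling G f \<longleftrightarrow>
     bij_betw f (edges G) {1..card (edges G)} \<and>
     (\<forall>u v. {u, v} \<in> edges G \<longrightarrow> vertex_sum G f u \<noteq> vertex_sum G f v)"

text \<open>On natural numbers the infimum of a nonempty set is its minimum and the infimum of the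
  empty set is 0. So a graph without a local antimagic labeling gets the value 0,
  and any equation with a positive right-hand side includes the existence of a labeling.\<close>

definition local_antimagic_chromatic_number :: "'a graph \<Rightarrow> nat" (\<open>\<chi>\<^sub>l\<^sub>a\<close>) where
  "\<chi>\<^sub>l\<^sub>a G = Inf {card (vertex_sum G f ` verts G) | f. local_antimagic_labeling G f}"

lemma simple_graph_null_graph: "simple_graph (null_graph m)"
  by (simp add: simple_graph_def null_graph_def)

lemma simple_graph_path_graph: "simple_graph (path_graph n)"
  by (auto simp: simple_graph_def path_graph_def)

lemma simple_graph_copies:
  assumes "simple_graph G" shows "simple_graph (copies a G)"
proof -
  have "card (Pair i ` e) = card e" for i :: nat and e :: "'a set"
    by (simp add: card_image inj_on_def)
  then show ?thesis
    using assms unfolding simple_graph_def copies_def by fastforce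
qed

lemma simple_graph_graph_join:
  assumes "simple_graph G" "simple_graph H" shows "simple_graph (graph_join G H)"
proof -
  have "card (Inl ` e :: ('a + 'b) set) = card e" for e :: "'a set"
    by (simp add: card_image)
  moreover have "card (Inr ` e :: ('a + 'b) set) = card e" for e :: "'b set"
    by (simp add: card_image)
  ultimately show ?thesis
    using assms unfolding simple_graph_def graph_join_def by fastforce
qed

end

theory Submission
  imports Defs
begin

text \<open>
  A triangle forces at least three vertex sums. For the upper bound put \<open>m = 2 * k + 1\<close> and
  arrange the labels \<open>1, \<dots>, (4 * n + 1) * m\<close> in \<open>4 * n + 1\<close> rows of \<open>m\<close> consecutive numbers,
  each row being permuted. The middle row labels the \<open>m\<close> copies of \<open>P\<^sub>2\<close>, and rows \<open>j\<close> and
  \<open>4 * n - j\<close> label the edges at the \<open>j\<close>-th vertex of the null graph that lead to the first,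
  respectively second, ends of the copies of \<open>P\<^sub>2\<close>. Permutations are chosen so that every
  column has the same sum over the rows \<open>0, \<dots>, 2 * n\<close> and also over the rows \<open>2 * n, \<dots>, 4 * n\<close>:
  three rows use permutations with constant total, which exist because \<open>m\<close> is odd, and the
  remaining ones are paired as \<open>i\<close> and \<open>m - 1 - i\<close>. This leaves three vertex sums, and a
  divisibility argument modulo \<open>m\<close> shows that they are distinct.
\<close>

section \<open>Labelings and triangles\<close>

lemma three_le_card_vertex_sums_of_triangle:
  assumes "finite (verts G)" and "local_antimagic_labeling G f"
    and "{u, v} \<in> edges G" "{v, w} \<in> edges G" "{u, w} \<in> edges G"
    and "u \<in> verts G" "v \<in> verts G" "w \<in> verts G"
  shows "3 \<le> card (vertex_sum G f ` verts G)"
proof -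
  let ?s = "vertex_sum G f"
  have "?s u \<noteq> ?s v" "?s v \<noteq> ?s w" "?s u \<noteq> ?s w"
    using assms(2-5) unfolding local_antimagic_labeling_def by blast+
  then have "card {?s u, ?s v, ?s w} = 3" by simp
  moreover have "card {?s u, ?s v, ?s w} \<le> card (?s ` verts G)"
    using assms(1,6-8) by (intro card_mono) auto
  ultimately show ?thesis by simp
qed

text \<open>Lets vertex sums be computed over the cells of an array, through any bijection
  \<open>E\<close> from the cells to the edges.\<close>

lemma vertex_sum_parametrized:
  assumes "bij_betw E I (edges G)" and "\<And>x. x \<in> I \<Longrightarrow> f (E x) = L x"
  shows "vertex_sum G f u = (\<Sum>x \<in> {x \<in> I. u \<in> E x}. L x)"
proof -
  have "bij_betw E {x \<in> I. u \<in> E x} {e \<in> edges G. u \<in> e}"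
    by (rule bij_betw_subset[OF assms(1)]) (use assms(1) in \<open>auto simp: bij_betw_def\<close>)
  then have "vertex_sum G f u = (\<Sum>x \<in> {x \<in> I. u \<in> E x}. f (E x))"
    unfolding vertex_sum_def by (rule sum.reindex_bij_betw[symmetric])
  also have "\<dots> = (\<Sum>x \<in> {x \<in> I. u \<in> E x}. L x)"
    using assms(2) by (intro sum.cong) auto
  finally show ?thesis .
qed

section \<open>The array of labels\<close>

text \<open>The values run down from \<open>k\<close> to \<open>0\<close> on even positions and from
  \<open>2 * k\<close> to \<open>k + 1\<close> on odd ones. The second permutation runs from
  \<open>2 * k\<close> to \<open>k\<close> and from \<open>k - 1\<close> to \<open>0\<close>. Adding
  the identity makes every column total constant.\<close>

definition first_balancing_perm :: "nat \<Rightarrow> nat \<Rightarrow> nat" where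
  "first_balancing_perm k i = (if even i then k - i div 2 else 2 * k - i div 2)"

definition second_balancing_perm :: "nat \<Rightarrow> nat \<Rightarrow> nat" where
  "second_balancing_perm k i = (if even i then 2 * k - i div 2 else k - 1 - i div 2)"

text \<open>Rows \<open>0\<close>, \<open>1\<close>, \<open>2\<close> form the balanced triple, with
  the identity in row \<open>2\<close>. After them each reversed odd row pairs with the even row
  that follows it.\<close>

definition row_perm :: "nat \<Rightarrow> nat \<Rightarrow> nat \<Rightarrow> nat" where
  "row_perm k r =
     (if r = 0 then first_balancing_perm k
      else if r = 1 then second_balancing_perm k
      else if even r then (\<lambda>i. i) else (\<lambda>i. 2 * k - i))"

text \<open>The \<open>min\<close> reflects the permutations in the middle row \<open>2 * n\<close>,
  so \<open>sum_row_perm_column\<close> serves both halves of a column.\<close>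

definition label_array :: "nat \<Rightarrow> nat \<Rightarrow> nat \<times> nat \<Rightarrow> nat" where
  "label_array n k = (\<lambda>(r, i). r * (2 * k + 1) + 1 + row_perm k (min r (4 * n - r)) i)"

lemma balancing_perms_sum:
  assumes "i < 2 * k + 1"
  shows "first_balancing_perm k i + second_balancing_perm k i + i = 3 * k"
proof (cases "even i")
  case True
  then obtain s where "i = 2 * s" by (rule evenE)
  then show ?thesis using assms by (simp add: first_balancing_perm_def second_balancing_perm_def)
next
  case False
  then obtain s where "i = 2 * s + 1" by (rule oddE)
  then show ?thesis using assms by (simp add: first_balancing_perm_def second_balancing_perm_def)
qed

lemma row_perm_less: "i < 2 * k + 1 \<Longrightarrow> row_perm k r i < 2 * k + 1"
  unfolding row_perm_def first_balancing_perm_def second_balancing_perm_def by auto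

lemma inj_on_row_perm: "inj_on (row_perm k r) {..<2 * k + 1}"
proof -
  have "inj_on (first_balancing_perm k) {..<2 * k + 1}"
    unfolding inj_on_def first_balancing_perm_def by (auto elim!: evenE oddE)
  moreover have "inj_on (second_balancing_perm k) {..<2 * k + 1}"
    unfolding inj_on_def second_balancing_perm_def by (auto elim!: evenE oddE)
  moreover have "inj_on (\<lambda>i. 2 * k - i) {..<2 * k + 1}"
    unfolding inj_on_def by auto
  ultimately show ?thesis unfolding row_perm_def by auto
qed

lemma sum_row_perm_row: "(\<Sum>i<2 * k + 1. row_perm k r i) = k * (2 * k + 1)"
proof -
  have "row_perm k r ` {..<2 * k + 1} = {..<2 * k + 1}"
    by (intro endo_inj_surj inj_on_row_perm) (auto intro: row_perm_less[simplified])
  then have "(\<Sum>i<2 * k + 1. row_perm k r i) = (\<Sum>i<2 * k + 1. i)"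
    using sum.reindex[OF inj_on_row_perm, of "\<lambda>x. x" k r] by simp
  also have "\<dots> = k * (2 * k + 1)"
    by (induction k) auto
  finally show ?thesis .
qed

lemma sum_row_perm_column:
  assumes "n \<ge> 1" and i: "i < 2 * k + 1"
  shows "(\<Sum>r\<le>2 * n. row_perm k r i) = k * (2 * n + 1)"
  using assms(1)
proof (induction n rule: dec_induct)
  case base
  have "{..2 * 1} = {0, 1, 2::nat}" by auto
  then show ?case using balancing_perms_sum[OF i] by (simp add: row_perm_def)
next
  case (step n)
  have "{..2 * Suc n} = insert (2 * n + 2) (insert (2 * n + 1) {..2 * n})" by auto
  \<comment> \<open>As \<open>n \<ge> 1\<close>, both rows lie beyond the balanced triple: one is
    the identity, the other its reversal.\<close>
  moreover have "row_perm k (2 * n + 2) i + row_perm k (2 * n + 1) i = 2 * k"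
    using step.hyps i by (simp add: row_perm_def)
  ultimately show ?case using step.IH by simp
qed

text \<open>Division by \<open>2 * k + 1\<close> recovers the row as quotient, and the remainder
  determines the column because each row is a permutation. Surjectivity follows by counting.\<close>

lemma bij_betw_label_array:
  "bij_betw (label_array n k) ({..<4 * n + 1} \<times> {..<2 * k + 1}) {1..(4 * n + 1) * (2 * k + 1)}"
proof -
  let ?m = "2 * k + 1"
  let ?I = "{..<4 * n + 1} \<times> {..<?m}"
  have inj: "inj_on (label_array n k) ?I"
  proof (rule inj_onI)
    fix x y
    assume "x \<in> ?I" "y \<in> ?I" and xy: "label_array n k x = label_array n k y"
    then obtain r i s j where x: "x = (r, i)" and y: "y = (s, j)"
      and ij: "i \<in> {..<?m}" "j \<in> {..<?m}"
      by blast
    have eq: "label_array n k (r, i) = label_array n k (s, j)" using xy x y by simp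
    define a where "a = row_perm k (min r (4 * n - r)) i"
    define b where "b = row_perm k (min s (4 * n - s)) j"
    have less: "a < ?m" "b < ?m"
      using ij row_perm_less unfolding a_def b_def by auto
    have eq': "r * ?m + a = s * ?m + b"
      using eq unfolding label_array_def a_def b_def by simp
    have "(r * ?m + a) div ?m = r" "(s * ?m + b) div ?m = s"
      using less by (simp_all only: div_mult_self3 div_less)
    then have "r = s" using eq' by metis
    with eq' have "a = b" by simp
    with \<open>r = s\<close> ij have "i = j"
      unfolding a_def b_def using inj_onD[OF inj_on_row_perm] by blast
    with \<open>r = s\<close> x y show "x = y" by simp
  qed
  have "label_array n k x \<in> {1..(4 * n + 1) * ?m}" if "x \<in> ?I" for x
  proof -
    obtain r i where x: "x = (r, i)" "r \<le> 4 * n" "i < ?m" using \<open>x \<in> ?I\<close> by auto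
    have "r * ?m \<le> 4 * n * ?m" using x(2) by (rule mult_le_mono1)
    then show ?thesis
      using row_perm_less[OF x(3), of "min r (4 * n - r)"]
      by (simp add: x(1) label_array_def)
  qed
  then have "label_array n k ` ?I \<subseteq> {1..(4 * n + 1) * ?m}" by blast
  moreover have "card (label_array n k ` ?I) = card {1..(4 * n + 1) * ?m}"
    using card_image[OF inj] by simp
  ultimately have "label_array n k ` ?I = {1..(4 * n + 1) * ?m}"
    by (intro card_subset_eq) auto
  with inj show ?thesis unfolding bij_betw_def by blast
qed

lemma sum_label_array_upper_column:
  assumes "n \<ge> 1" "i < 2 * k + 1"
  shows "(\<Sum>r\<le>2 * n. label_array n k (r, i)) = (2 * n + 1) * (n * (2 * k + 1) + k + 1)"
proof -
  have "(\<Sum>r\<le>2 * n. label_array n k (r, i)) = (\<Sum>r\<le>2 * n. r * (2 * k + 1) + 1 + row_perm k r i)"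
    by (intro sum.cong) (auto simp: label_array_def min_def)
  also have "\<dots> = (\<Sum>r\<le>2 * n. r) * (2 * k + 1) + (2 * n + 1) + k * (2 * n + 1)"
    unfolding sum.distrib sum_row_perm_column[OF assms] sum_distrib_right by simp
  also have "(\<Sum>r\<le>2 * n. r) = n * (2 * n + 1)"
    by (induction n) auto
  finally show ?thesis by (simp add: algebra_simps)
qed

lemma sum_label_array_lower_column:
  assumes "n \<ge> 1" "i < 2 * k + 1"
  shows "(\<Sum>r = 2 * n..4 * n. label_array n k (r, i)) = (2 * n + 1) * (3 * n * (2 * k + 1) + k + 1)"
proof -
  have "(\<Sum>r = 2 * n..4 * n. label_array n k (r, i))
      = (\<Sum>r\<le>2 * n. (2 * n + (2 * n - r)) * (2 * k + 1) + 1 + row_perm k r i)"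
    by (rule sum.reindex_bij_witness[of _ "\<lambda>r. 4 * n - r" "\<lambda>r. 4 * n - r"])
      (auto simp: label_array_def min_absorb2)
  also have "\<dots> = (\<Sum>r\<le>2 * n. 2 * n + (2 * n - r)) * (2 * k + 1) + (2 * n + 1) + k * (2 * n + 1)"
    unfolding sum.distrib[where h = "\<lambda>r. row_perm k r i"] sum.distrib[where h = "\<lambda>_. 1"]
      sum_row_perm_column[OF assms] sum_distrib_right by (simp only: sum_constant card_atMost) simp
  also have "(\<Sum>r\<le>2 * n. 2 * n + (2 * n - r)) = 3 * n * (2 * n + 1)"
    unfolding sum.distrib
  proof -
    have "(\<Sum>r\<le>2 * n. 2 * n - r) = (\<Sum>r\<le>2 * n. r)"
      by (rule sum.reindex_bij_witness[of _ "\<lambda>r. 2 * n - r" "\<lambda>r. 2 * n - r"]) auto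
    also have "\<dots> = n * (2 * n + 1)" by (induction n) auto
    finally show "(\<Sum>r\<le>2 * n. 2 * n) + (\<Sum>r\<le>2 * n. 2 * n - r) = 3 * n * (2 * n + 1)"
      by (simp only: sum_constant card_atMost) (simp add: algebra_simps)
  qed
  finally show ?thesis by (simp add: algebra_simps)
qed

text \<open>Row totals do not depend on the permutations, and the two row numbers add up to
  \<open>4 * n\<close>, so \<open>j\<close> cancels. The bound on \<open>j\<close> keeps the two
  rows distinct.\<close>

lemma sum_label_array_row_pair:
  assumes "j < 2 * n"
  shows "(\<Sum>x \<in> {j, 4 * n - j} \<times> {..<2 * k + 1}. label_array n k x)
       = (2 * k + 1) * (4 * n * (2 * k + 1) + 2 * (k + 1))"
proof -
  let ?m = "2 * k + 1"
  have ne: "j \<noteq> 4 * n - j" using assms by simp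
  have row: "(\<Sum>i<?m. label_array n k (r, i)) = r * ?m * ?m + ?m + k * ?m" for r
    unfolding label_array_def split sum.distrib sum_row_perm_row by simp
  have "(\<Sum>x \<in> {j, 4 * n - j} \<times> {..<?m}. label_array n k x)
      = (\<Sum>r \<in> {j, 4 * n - j}. \<Sum>i<?m. label_array n k (r, i))"
    unfolding sum.cartesian_product by simp
  also have "\<dots> = (j + (4 * n - j)) * ?m * ?m + 2 * ?m + 2 * k * ?m"
    unfolding row using ne by (subst sum.insert) (simp_all add: algebra_simps)
  also have "j + (4 * n - j) = 4 * n" using assms by simp
  finally show ?thesis by (simp add: algebra_simps)
qed

section \<open>The three vertex sums differ\<close>

text \<open>The cases \<open>c = 1\<close> and \<open>c = 3\<close> are the coincidences of a first
  or second end with a null-graph vertex. Modulo \<open>2 * k + 1\<close> the equation leaves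
  \<open>(2 * n + 1) * (k + 1)\<close>, whose second factor is coprime to the modulus.\<close>

lemma odd_multiple_of_vertex_sum_coincidence:
  fixes n k c :: nat
  assumes "(2 * n + 1) * (c * n * (2 * k + 1) + k + 1)
         = (2 * k + 1) * (4 * n * (2 * k + 1) + 2 * (k + 1))"
  obtains t where "odd t" "2 * n + 1 = t * (2 * k + 1)"
proof -
  let ?m = "2 * k + 1"
  have "?m dvd (2 * n + 1) * (c * n * ?m + k + 1)"
    unfolding assms by (rule dvd_triv_left)
  moreover have "(2 * n + 1) * (c * n * ?m + k + 1)
      = (2 * n + 1) * (c * n) * ?m + (2 * n + 1) * (k + 1)"
    by (simp add: algebra_simps)
  ultimately have "?m dvd (2 * n + 1) * (k + 1)"
    by (metis dvd_add_right_iff dvd_triv_right)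
  moreover have "coprime ?m (k + 1)"
  proof -
    \<comment> \<open>A common divisor divides \<open>2 * (k + 1) - (2 * k + 1) = 1\<close>.\<close>
    have "is_unit d" if "d dvd ?m" "d dvd k + 1" for d
      using dvd_diff_nat[OF dvd_mult[OF that(2), of 2] that(1)] by simp
    then show ?thesis by (rule coprimeI)
  qed
  ultimately have "?m dvd 2 * n + 1"
    by (simp only: coprime_dvd_mult_left_iff)
  then obtain t where t: "2 * n + 1 = t * ?m" by (metis dvdE mult.commute)
  have "odd (t * ?m)" unfolding t[symmetric] by simp
  then have "odd t" by simp
  with t show ?thesis by (rule that[rotated])
qed

lemma first_end_sum_neq_null_vertex_sum:
  fixes n k :: nat
  assumes "k \<ge> 1"
  shows "(2 * n + 1) * (n * (2 * k + 1) + k + 1)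
       \<noteq> (2 * k + 1) * (4 * n * (2 * k + 1) + 2 * (k + 1))"
proof
  assume eq: "(2 * n + 1) * (n * (2 * k + 1) + k + 1)
       = (2 * k + 1) * (4 * n * (2 * k + 1) + 2 * (k + 1))"
  then obtain t where "odd t" and t: "2 * n + 1 = t * (2 * k + 1)"
    using odd_multiple_of_vertex_sum_coincidence[of n 1 k] by auto
  define m N T where "m = int (2 * k + 1)" and "N = int n" and "T = int t"
  have m: "m \<ge> 3" using assms unfolding m_def by simp
  have tm: "2 * N + 1 = T * m"
    using arg_cong[OF t, of int] unfolding m_def N_def T_def by (simp add: algebra_simps)
  \<comment> \<open>The equation is doubled so that \<open>2 * (k + 1)\<close> becomes
    \<open>m + 1\<close> and \<open>k\<close> disappears.\<close>
  have "(2 * N + 1) * (2 * N * m + (m + 1)) = m * (8 * N * m + 2 * (m + 1))"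
    using arg_cong[OF eq, of int] unfolding m_def N_def by (simp add: algebra_simps)
  then have "m * (T * ((2 * N) * m + (m + 1))) = m * (4 * (2 * N) * m + 2 * (m + 1))"
    unfolding tm by (simp add: algebra_simps)
  then have "T * ((2 * N) * m + (m + 1)) = 4 * (2 * N) * m + 2 * (m + 1)"
    using m by simp
  moreover have "2 * N = T * m - 1" using tm by simp
  ultimately have key: "T * ((T * m - 1) * m + (m + 1)) = 4 * (T * m - 1) * m + 2 * (m + 1)"
    by simp
  \<comment> \<open>Expanding \<open>key\<close> gives
    \<open>(T - 4) * T * m^2 = 2 - T - 2 * m\<close>. The right side is negative for
    \<open>T \<ge> 4\<close>; the smaller odd values leave quadratics in \<open>m\<close> without a
    root \<open>m \<ge> 3\<close>.\<close>
  have "T = 1 \<or> T = 3 \<or> T \<ge> 4"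
    using \<open>odd t\<close> unfolding T_def by presburger
  then show False
  proof (elim disjE)
    assume "T = 1"
    with key have "m * (3 * m - 2) = -1" by (simp add: algebra_simps)
    moreover have "m * (3 * m - 2) \<ge> 0" using m by simp
    ultimately show False by simp
  next
    assume "T = 3"
    with key have "(3 * m + 1) * (m - 1) = 0" by (simp add: algebra_simps)
    with m show False by simp
  next
    assume "T \<ge> 4"
    then have "(T - 4) * (T * (m * m)) \<ge> 0" by simp
    moreover from key have "(T - 4) * (T * (m * m)) = 2 - T - 2 * m" by (simp add: algebra_simps)
    ultimately show False using m \<open>T \<ge> 4\<close> by simp
  qed
qed

lemma second_end_sum_neq_null_vertex_sum:
  fixes n k :: nat
  assumes "k \<ge> 1"
  shows "(2 * n + 1) * (3 * n * (2 * k + 1) + k + 1)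
       \<noteq> (2 * k + 1) * (4 * n * (2 * k + 1) + 2 * (k + 1))"
proof
  assume eq: "(2 * n + 1) * (3 * n * (2 * k + 1) + k + 1)
       = (2 * k + 1) * (4 * n * (2 * k + 1) + 2 * (k + 1))"
  then obtain t where "odd t" and t: "2 * n + 1 = t * (2 * k + 1)"
    by (rule odd_multiple_of_vertex_sum_coincidence)
  define m N T where "m = int (2 * k + 1)" and "N = int n" and "T = int t"
  have m: "m \<ge> 3" using assms unfolding m_def by simp
  have tm: "2 * N + 1 = T * m"
    using arg_cong[OF t, of int] unfolding m_def N_def T_def by (simp add: algebra_simps)
  have "(2 * N + 1) * (6 * N * m + (m + 1)) = m * (8 * N * m + 2 * (m + 1))"
    using arg_cong[OF eq, of int] unfolding m_def N_def by (simp add: algebra_simps)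
  then have "m * (T * (3 * (2 * N) * m + (m + 1))) = m * (4 * (2 * N) * m + 2 * (m + 1))"
    unfolding tm by (simp add: algebra_simps)
  then have "T * (3 * (2 * N) * m + (m + 1)) = 4 * (2 * N) * m + 2 * (m + 1)"
    using m by simp
  moreover have "2 * N = T * m - 1" using tm by simp
  ultimately have key: "T * (3 * (T * m - 1) * m + (m + 1)) = 4 * (T * m - 1) * m + 2 * (m + 1)"
    by simp
  have "T = 1 \<or> T \<ge> 2"
    using \<open>odd t\<close> unfolding T_def by presburger
  then show False
  proof (elim disjE)
    assume "T = 1"
    with key have "m * m = -1" by (simp add: algebra_simps)
    moreover have "m * m \<ge> 0" by simp
    ultimately show False by simp
  next
    assume "T \<ge> 2"
    then have "(T - 2) * (T * (m * m)) \<ge> 0" "T * (m * (m - 1)) \<ge> 0" using m by simp_all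
    \<comment> \<open>The terms of \<open>key\<close> are grouped through
      \<open>3 * T - 4 = 3 * (T - 2) + 2\<close>, so that the left side is visibly nonnegative while
      the right side is negative.\<close>
    moreover from key have "3 * ((T - 2) * (T * (m * m))) + 2 * (T * (m * (m - 1))) = 2 - T - 2 * m"
      by (simp add: algebra_simps)
    ultimately show False using m \<open>T \<ge> 2\<close> by linarith
  qed
qed

section \<open>The join\<close>

abbreviation (input) P2_join :: "nat \<Rightarrow> nat \<Rightarrow> ((nat \<times> nat) + nat) graph" where
  "P2_join m l \<equiv> graph_join (copies m (path_graph 2)) (null_graph l)"

lemma verts_P2_join: "verts (P2_join m l) = ({..<m} \<times> {0, 1}) <+> {..<l}"
  by (auto simp: graph_join_def copies_def path_graph_def null_graph_def)

lemma edges_P2_join: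
  "edges (P2_join m l) =
     {{Inl (i, 0), Inl (i, 1)} | i. i < m} \<union>
     {{Inl (i, 0), Inr j} | i j. i < m \<and> j < l} \<union>
     {{Inl (i, 1), Inr j} | i j. i < m \<and> j < l}"
proof -
  have P2: "edges (path_graph 2) = {{0, 1}}" "verts (path_graph 2) = {0, 1}"
    by (auto simp: path_graph_def)
  have "edges (copies m (path_graph 2)) = {{(i, 0), (i, 1)} | i. i < m}"
    unfolding copies_def P2 by auto
  moreover have "verts (copies m (path_graph 2)) = {..<m} \<times> {0, 1}"
    unfolding copies_def P2 by auto
  moreover have "image Inl ` {{(i, 0), (i, 1)} | i. i < m} =
      ({{Inl (i, 0), Inl (i, 1)} | i. i < m} :: ((nat \<times> nat) + nat) set set)"
    by (simp add: setcompr_eq_image image_image)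
  \<comment> \<open>The join edges split by the end of \<open>P\<^sub>2\<close> they meet;
    abstracting the edge as \<open>F\<close> makes this purely set-theoretic.\<close>
  moreover have "{F u v | u v. u \<in> {..<m} \<times> {0, 1} \<and> v \<in> {..<l}} =
      {F (i, 0) j | i j. i < m \<and> j < l} \<union> {F (i, 1) j | i j. i < m \<and> j < l}"
    for F :: "nat \<times> nat \<Rightarrow> nat \<Rightarrow> ((nat \<times> nat) + nat) set"
    by blast
  note this[of "\<lambda>u v. {Inl u, Inr v}"]
  ultimately show ?thesis
    by (simp only: graph_join_def null_graph_def graph.simps image_empty Un_empty_right Un_assoc)
qed

lemma P2_join_edges:
  "i < m \<Longrightarrow> {Inl (i, 0), Inl (i, 1)} \<in> edges (P2_join m l)"
  "i < m \<Longrightarrow> j < l \<Longrightarrow> {Inl (i, 0), Inr j} \<in> edges (P2_join m l)"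
  "i < m \<Longrightarrow> j < l \<Longrightarrow> {Inl (i, 1), Inr j} \<in> edges (P2_join m l)"
  unfolding edges_P2_join
    apply (rule UnI1, rule UnI1, intro CollectI exI conjI, rule refl, assumption)
   apply (rule UnI1, rule UnI2, intro CollectI exI conjI, rule refl, assumption+)
  apply (rule UnI2, intro CollectI exI conjI, rule refl, assumption+)
  done

lemma P2_join_edge_cases:
  assumes "e \<in> edges (P2_join m l)"
  obtains (P2) i where "i < m" "e = {Inl (i, 0), Inl (i, 1)}"
    | (first) i j where "i < m" "j < l" "e = {Inl (i, 0), Inr j}"
    | (second) i j where "i < m" "j < l" "e = {Inl (i, 1), Inr j}"
  using assms unfolding edges_P2_join by (elim UnE CollectE exE conjE) blast+

definition edge_array :: "nat \<Rightarrow> nat \<times> nat \<Rightarrow> ((nat \<times> nat) + nat) set" where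
  "edge_array n = (\<lambda>(r, i).
     if r < 2 * n then {Inl (i, 0), Inr r}
     else if r = 2 * n then {Inl (i, 0), Inl (i, 1)}
     else {Inl (i, 1), Inr (4 * n - r)})"

lemma bij_betw_edge_array:
  "bij_betw (edge_array n) ({..<4 * n + 1} \<times> {..<m}) (edges (P2_join m (2 * n)))"
proof -
  let ?I = "{..<4 * n + 1} \<times> {..<m}"
  have "inj_on (edge_array n) ?I"
    by (auto simp: inj_on_def edge_array_def doubleton_eq_iff split: if_splits)
  moreover have "edge_array n x \<in> edges (P2_join m (2 * n))" if "x \<in> ?I" for x
  proof -
    obtain r i where x: "x = (r, i)" "r \<le> 4 * n" "i < m" using \<open>x \<in> ?I\<close> by auto
    consider "r < 2 * n" | "r = 2 * n" | "r > 2 * n" by linarith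
    then show ?thesis
      by cases (use x P2_join_edges in \<open>simp_all add: edge_array_def\<close>)
  qed
  moreover have "e \<in> edge_array n ` ?I" if "e \<in> edges (P2_join m (2 * n))" for e
    using that
  proof (cases rule: P2_join_edge_cases)
    case (P2 i)
    then show ?thesis by (intro image_eqI[of _ _ "(2 * n, i)"]) (simp_all add: edge_array_def)
  next
    case (first i j)
    then show ?thesis by (intro image_eqI[of _ _ "(j, i)"]) (simp_all add: edge_array_def)
  next
    case (second i j)
    then show ?thesis by (intro image_eqI[of _ _ "(4 * n - j, i)"]) (auto simp: edge_array_def)
  qed
  ultimately show ?thesis unfolding bij_betw_def by blast
qed

text \<open>The cells at each vertex form a rectangle: half a column for an end of a
  \<open>P2\<close> copy, a mirrored pair of rows for a null-graph vertex. Row \<open>2 * n\<close>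
  occurs in both halves, since its edges join the two ends.\<close>

lemma edge_array_incidence:
  "i < m \<Longrightarrow> {x \<in> {..<4 * n + 1} \<times> {..<m}. Inl (i, 0) \<in> edge_array n x} = {..2 * n} \<times> {i}"
  "i < m \<Longrightarrow> {x \<in> {..<4 * n + 1} \<times> {..<m}. Inl (i, 1) \<in> edge_array n x} = {2 * n..4 * n} \<times> {i}"
  "j < 2 * n \<Longrightarrow>
     {x \<in> {..<4 * n + 1} \<times> {..<m}. Inr j \<in> edge_array n x} = {j, 4 * n - j} \<times> {..<m}"
  by (auto simp: edge_array_def split: if_splits)

lemma P2_join_three_sums:
  assumes "n \<ge> 1" "k \<ge> 1"
  obtains f where "local_antimagic_labeling (P2_join (2 * k + 1) (2 * n)) f"
    and "card (vertex_sum (P2_join (2 * k + 1) (2 * n)) f ` verts (P2_join (2 * k + 1) (2 * n))) \<le> 3"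
proof -
  define m where "m = 2 * k + 1"
  let ?G = "P2_join m (2 * n)"
  define I where "I = {..<4 * n + 1} \<times> {..<m}"
  \<comment> \<open>Each edge gets the label stored in its cell.\<close>
  define f where "f = label_array n k \<circ> inv_into I (edge_array n)"
  define A where "A = (2 * n + 1) * (n * m + k + 1)"
  define B where "B = (2 * n + 1) * (3 * n * m + k + 1)"
  define C where "C = m * (4 * n * m + 2 * (k + 1))"
  have E: "bij_betw (edge_array n) I (edges ?G)"
    unfolding I_def by (rule bij_betw_edge_array)
  have "f (edge_array n x) = label_array n k x" if "x \<in> I" for x
    using that E by (simp add: f_def bij_betw_inv_into_left)
  then have sum: "vertex_sum ?G f u = (\<Sum>x \<in> {x \<in> I. u \<in> edge_array n x}. label_array n k x)" for u
    by (rule vertex_sum_parametrized[OF E])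
  have column: "(\<Sum>x \<in> R \<times> {i}. label_array n k x) = (\<Sum>r \<in> R. label_array n k (r, i))" for R i
    using sum.cartesian_product[of "\<lambda>r c. label_array n k (r, c)" "{i}" R] by simp
  have sA: "vertex_sum ?G f (Inl (i, 0)) = A" if "i < m" for i
    unfolding sum I_def edge_array_incidence(1)[OF that] column
    unfolding A_def m_def by (rule sum_label_array_upper_column[OF assms(1) that[unfolded m_def]])
  have sB: "vertex_sum ?G f (Inl (i, 1)) = B" if "i < m" for i
    unfolding sum I_def edge_array_incidence(2)[OF that] column
    unfolding B_def m_def by (rule sum_label_array_lower_column[OF assms(1) that[unfolded m_def]])
  have sC: "vertex_sum ?G f (Inr j) = C" if "j < 2 * n" for j
    unfolding sum I_def edge_array_incidence(3)[OF that]
    unfolding C_def m_def by (rule sum_label_array_row_pair[OF that])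
  have "0 < n * m" using assms(1) unfolding m_def by simp
  then have "A < B" unfolding A_def B_def by (intro mult_strict_left_mono) simp_all
  then have "A \<noteq> B" by simp
  have "A \<noteq> C"
    unfolding A_def C_def m_def by (rule first_end_sum_neq_null_vertex_sum[OF assms(2)])
  have "B \<noteq> C"
    unfolding B_def C_def m_def by (rule second_end_sum_neq_null_vertex_sum[OF assms(2)])
  have proper: "vertex_sum ?G f u \<noteq> vertex_sum ?G f v" if "{u, v} \<in> edges ?G" for u v
    using that
  proof (cases rule: P2_join_edge_cases)
    case (P2 i)
    then show ?thesis using \<open>A \<noteq> B\<close> sA sB unfolding doubleton_eq_iff by metis
  next
    case (first i j)
    then show ?thesis using \<open>A \<noteq> C\<close> sA sC unfolding doubleton_eq_iff by metis
  next
    case (second i j)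
    then show ?thesis using \<open>B \<noteq> C\<close> sB sC unfolding doubleton_eq_iff by metis
  qed
  have "card (edges ?G) = (4 * n + 1) * m"
    using bij_betw_same_card[OF E] by (simp add: I_def)
  moreover have "bij_betw f (edges ?G) {1..(4 * n + 1) * m}"
    unfolding f_def
    using bij_betw_trans[OF bij_betw_inv_into[OF E]
        bij_betw_label_array[of n k, folded m_def, folded I_def]] .
  ultimately have "local_antimagic_labeling ?G f"
    unfolding local_antimagic_labeling_def using proper by simp
  moreover have "vertex_sum ?G f ` verts ?G \<subseteq> {A, B, C}"
    unfolding verts_P2_join using sA sB sC by auto
  then have "card (vertex_sum ?G f ` verts ?G) \<le> card {A, B, C}"
    by (intro card_mono) auto
  then have "card (vertex_sum ?G f ` verts ?G) \<le> 3"
    by (rule order_trans) (simp add: card_insert_if)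
  ultimately show ?thesis using that unfolding m_def by blast
qed

theorem theorem2p1:
  fixes n k :: nat
  assumes "n \<ge> 1" and "k \<ge> 1"
  shows "\<chi>\<^sub>l\<^sub>a (graph_join (copies (2 * k + 1) (path_graph 2)) (null_graph (2 * n))) = 3"
proof -
  let ?G = "P2_join (2 * k + 1) (2 * n)"
  have lower: "3 \<le> card (vertex_sum ?G f ` verts ?G)" if "local_antimagic_labeling ?G f" for f
  proof (rule three_le_card_vertex_sums_of_triangle[OF _ that])
    show "finite (verts ?G)" unfolding verts_P2_join by simp
    have "0 < 2 * k + 1" "0 < 2 * n" using assms by simp_all
    \<comment> \<open>The triangle consists of one copy of the path and one null-graph vertex, which
      exists because \<open>n \<ge> 1\<close>.\<close>
    then show "{Inl (0, 0), Inl (0, 1)} \<in> edges ?G" "{Inl (0, 1), Inr 0} \<in> edges ?G"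
      "{Inl (0, 0), Inr 0} \<in> edges ?G"
      by (simp_all only: P2_join_edges)
    show "Inl (0, 0) \<in> verts ?G" "Inl (0, 1) \<in> verts ?G" "Inr 0 \<in> verts ?G"
      using assms unfolding verts_P2_join by auto
  qed
  obtain f where f: "local_antimagic_labeling ?G f" "card (vertex_sum ?G f ` verts ?G) \<le> 3"
    using P2_join_three_sums[OF assms] .
  then have "card (vertex_sum ?G f ` verts ?G) = 3" using lower by (simp add: le_antisym)
  \<comment> \<open>The value 3 is attained by \<open>f\<close> and bounds all others from below, so
    the infimum is a true minimum and not the default 0.\<close>
  then show ?thesis
    unfolding local_antimagic_chromatic_number_def
    using f(1) lower by (intro cInf_eq_minimum) (auto intro: exI[of _ f])
qed

end
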